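(* For every integer $r\ge 3$ and positive integers $s_1\le s_2\le\cdots\le s_r$, $$\mathrm{mex}(m,K_r,K_{s_1,s_2,\ldots,s_r})=o\!\left(m^{\frac{(r-1)s}{r+s-2}}\right),\qquad\text{where } s=r-\frac{1}{\prod_{i=1}^{r-1}s_i}.$$
   Context: $\mathrm{mex}(m,K_r,F)$ is the maximum number of copies of $K_r$ in an $F$-free simple graph with $m$ edges; $K_{s_1,\ldots,s_r}$ is the complete $r$-partite graph with parts of sizes $s_1,\ldots,s_r$. Asymptotics are as $m\to\infty$. *)

theory Defs
  imports Complex_Main "HOL-Library.Landau_Symbols"
begin

type_synonym 'a ugraph = "'a set \<times> 'a set set"

abbreviation verts :: "'a ugraph \<Rightarrow> 'a set" where "verts G \<equiv> fst G"
abbreviation edges :: "'a ugraph \<Rightarrow> 'a set set" where "edges G \<equiv> snd G"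

definition simple_graph :: "'a ugraph \<Rightarrow> bool" where
  "simple_graph G \<longleftrightarrow> finite (verts G) \<and> edges G \<subseteq> {e. e \<subseteq> verts G \<and> card e = 2}"

definition subgraph :: "'a ugraph \<Rightarrow> 'a ugraph \<Rightarrow> bool" where
  "subgraph H G \<longleftrightarrow> simple_graph H \<and> verts H \<subseteq> verts G \<and> edges H \<subseteq> edges G"

definition graph_iso :: "'a ugraph \<Rightarrow> 'b ugraph \<Rightarrow> bool" where
  "graph_iso G H \<longleftrightarrow>
     (\<exists>f. bij_betw f (verts G) (verts H) \<and> edges H = (\<lambda>e. f ` e) ` edges G)"

text \<open>Copies are unlabelled and not necessarily induced.\<close>

definition copies :: "'b ugraph \<Rightarrow> 'a ugraph \<Rightarrow> 'a ugraph set" where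
  "copies H G = {H'. subgraph H' G \<and> graph_iso H H'}"

definition free_of :: "'b ugraph \<Rightarrow> 'a ugraph \<Rightarrow> bool" where
  "free_of F G \<longleftrightarrow> copies F G = {}"

definition complete_graph :: "nat \<Rightarrow> nat ugraph" where
  "complete_graph r = ({1..r}, {e. e \<subseteq> {1..r} \<and> card e = 2})"

text \<open>The vertex \<open>(i, j)\<close> is the \<open>j\<close>-th vertex of the \<open>i\<close>-th part.\<close>

definition complete_multipartite :: "nat \<Rightarrow> (nat \<Rightarrow> nat) \<Rightarrow> (nat \<times> nat) ugraph" where
  "complete_multipartite r s =
     (let V = (SIGMA i:{1..r}. {1..s i})
      in (V, {{x, y} | x y. x \<in> V \<and> y \<in> V \<and> fst x \<noteq> fst y}))"

definition copy_counts :: "nat \<Rightarrow> 'b ugraph \<Rightarrow> 'c ugraph \<Rightarrow> nat set" where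
  "copy_counts m H F =
     {card (copies H G) | G :: nat ugraph.
        simple_graph G \<and> card (edges G) = m \<and> free_of F G}"

text \<open>
  Every finite graph is isomorphic to one whose vertices are natural numbers. In general
  the set of counts may be empty or infinite, in which case \<^const>\<open>Max\<close> is
  unspecified; the lemmas below rule this out when complete graphs on at least two
  vertices are counted and a complete multipartite graph with at least three parts
  is forbidden.
\<close>

definition mex :: "nat \<Rightarrow> 'b ugraph \<Rightarrow> 'c ugraph \<Rightarrow> nat" where
  "mex m H F = Max (copy_counts m H F)"

lemma copy_of_complete_graph_verts:
  assumes "graph_iso (complete_graph r) H" "r \<ge> 2" "simple_graph H"
  shows "verts H = \<Union> (edges H)"
proof
  show "\<Union> (edges H) \<subseteq> verts H"
    using assms(3) by (auto simp: simple_graph_def)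
next
  obtain f where f: "bij_betw f {1..r} (verts H)"
    and E: "edges H = (\<lambda>e. f ` e) ` {e. e \<subseteq> {1..r} \<and> card e = 2}"
    using assms(1) by (auto simp: graph_iso_def complete_graph_def)
  show "verts H \<subseteq> \<Union> (edges H)"
  proof
    fix v assume "v \<in> verts H"
    then obtain x where x: "x \<in> {1..r}" "v = f x"
      using f unfolding bij_betw_def by blast
    define y where "y = (if x = 1 then 2 else 1 :: nat)"
    have "{x, y} \<in> {e. e \<subseteq> {1..r} \<and> card e = 2}"
      using x \<open>r \<ge> 2\<close> by (auto simp: y_def)
    hence "f ` {x, y} \<in> edges H"
      unfolding E by blast
    moreover have "v \<in> f ` {x, y}" using x by simp
    ultimately show "v \<in> \<Union> (edges H)" by blast
  qed
qed

lemma finite_copy_counts_complete_graph: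
  assumes "r \<ge> 2"
  shows "finite (copy_counts m (complete_graph r) F)"
proof -
  have "card (copies (complete_graph r) G) \<le> 2 ^ m"
    if G: "simple_graph G" "card (edges G) = m" for G :: "nat ugraph"
  proof -
    have fin: "finite (edges G)"
      using G(1) by (auto simp: simple_graph_def intro: finite_subset[of _ "Pow (verts G)"])
    have "inj_on snd (copies (complete_graph r) G)"
    proof (rule inj_onI)
      fix H H' assume "H \<in> copies (complete_graph r) G" "H' \<in> copies (complete_graph r) G"
        and "edges H = edges H'"
      thus "H = H'"
        using copy_of_complete_graph_verts[of r H] copy_of_complete_graph_verts[of r H'] assms
        by (auto simp: copies_def subgraph_def prod_eq_iff)
    qed
    moreover have "snd ` copies (complete_graph r) G \<subseteq> Pow (edges G)"
      by (auto simp: copies_def subgraph_def)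
    ultimately have "card (copies (complete_graph r) G) \<le> card (Pow (edges G))"
      using fin by (intro card_inj_on_le[of snd]) auto
    thus ?thesis using fin G(2) by (simp add: card_Pow)
  qed
  hence "copy_counts m (complete_graph r) F \<subseteq> {..2 ^ m}"
    by (auto simp: copy_counts_def)
  thus ?thesis by (rule finite_subset) simp
qed

lemma copy_counts_nonempty:
  assumes "r \<ge> 3" "\<forall>i\<in>{1..r}. s i > 0"
  shows "copy_counts m H (complete_multipartite r s) \<noteq> {}"
proof -
  define G :: "nat ugraph" where "G = ({0..m}, (\<lambda>i. {0, i}) ` {1..m})"
  have "simple_graph G"
    by (auto simp: simple_graph_def G_def card_insert_if)
  moreover have "inj_on (\<lambda>i::nat. {0, i}) {1..m}"
    by (auto simp: inj_on_def doubleton_eq_iff)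
  hence "card (edges G) = m"
    by (simp add: G_def card_image)
  moreover have "free_of (complete_multipartite r s) G"
    unfolding free_of_def
  proof (rule ccontr)
    assume "copies (complete_multipartite r s) G \<noteq> {}"
    then obtain K where K: "K \<in> copies (complete_multipartite r s) G" by blast
    then obtain f where f: "bij_betw f (verts (complete_multipartite r s)) (verts K)"
      and E: "edges K = (\<lambda>e. f ` e) ` edges (complete_multipartite r s)"
      and sub: "edges K \<subseteq> edges G"
      by (auto simp: copies_def subgraph_def graph_iso_def)
    have V: "(i, 1) \<in> verts (complete_multipartite r s)" if "i \<in> {1..3}" for i
      using that assms by (auto simp: complete_multipartite_def Let_def Suc_le_eq)
    have ne: "f (i, 1) \<noteq> f (j, 1)" if "i \<in> {1..3}" "j \<in> {1..3}" "i \<noteq> j" for i j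
      using f V[OF that(1)] V[OF that(2)] that(3) by (auto simp: bij_betw_def inj_on_def)
    have zero: "f (i, 1) = 0 \<or> f (j, 1) = 0"
      if "i \<in> {1..3}" "j \<in> {1..3}" "i \<noteq> j" for i j
    proof -
      have "{(i, 1), (j, 1)} \<in> edges (complete_multipartite r s)"
        using V[OF that(1)] V[OF that(2)] that(3)
        by (fastforce simp: complete_multipartite_def Let_def)
      hence "f ` {(i, 1), (j, 1)} \<in> edges G"
        using E sub by blast
      thus ?thesis by (auto simp: G_def doubleton_eq_iff)
    qed
    show False
      using zero[of 1 2] zero[of 1 3] zero[of 2 3] ne[of 1 2] ne[of 1 3] ne[of 2 3] by auto
  qed
  ultimately show ?thesis unfolding copy_counts_def by blast
qed

end

theory Submission imports Defs begin

text \<open>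
  Write \<open>p = s\<^sub>1 \<cdots> s\<^bsub>r-1\<^esub>\<close>, \<open>S = s\<^sub>1 + \<dots> + s\<^bsub>r-1\<^esub>\<close>, and let \<open>e\<close> be the exponent of the
  theorem. Splitting the vertices at the degree \<open>d = m\<^sup>a\<close> with \<open>a = (\<sigma>-1)/(r+\<sigma>-2)\<close> balances the two easy
  bounds: cliques through a vertex of degree at most \<open>d\<close> number \<open>O(m d\<^bsup>r-2\<^esup>) = O(m\<^sup>e)\<close>, and cliques on
  the at most \<open>2m/d\<close> other vertices number \<open>O((m/d)\<^sup>\<sigma>) = O(m\<^sup>e)\<close> by the argument of Erdos. Both
  bounds are lossy, so no removal lemma is needed and in fact a power of \<open>m\<close> is saved: cliques with a vertex of degree below
  \<open>m\<^bsup>a-\<delta>\<^esup>\<close> and cliques of vertices of degree above \<open>m\<^bsup>a+\<delta>\<^esup>\<close> contribute little, and for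
  a root \<open>x\<close> of intermediate degree the argument of Erdos is applied inside the neighbourhood of
  \<open>x\<close>. If there were about \<open>m\<^sup>e\<close> such cliques, the neighbourhoods of the roots would contain
  so many complete \<open>(r-1)\<close>-partite graphs with parts of sizes \<open>s\<^sub>1, \<dots>, s\<^bsub>r-1\<^esub>\<close> that one of them is shared by \<open>s\<^sub>r\<close> roots,
  the numerical reason being \<open>S - 1 < (r-1) p\<close>.
\<close>


section \<open>Blow-ups in multipartite hypergraphs\<close>

text \<open>Chebyshev's sum inequality for the equally ordered families \<open>f i\<close> and
  \<open>f i ^ n\<close>: the double sum is symmetrised and
  \<open>(f i - f j) * (f i ^ n - f j ^ n)\<close> is nonnegative.\<close>

lemma sum_mult_sum_power_le:
  fixes f :: "'a \<Rightarrow> real"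
  assumes "\<And>i. i \<in> I \<Longrightarrow> 0 \<le> f i"
  shows "(\<Sum>i\<in>I. f i) * (\<Sum>i\<in>I. f i ^ n) \<le> real (card I) * (\<Sum>i\<in>I. f i ^ Suc n)"
proof -
  have swap: "f i * f j ^ n + f j * f i ^ n \<le> f i ^ Suc n + f j ^ Suc n" if "i \<in> I" "j \<in> I" for i j
  proof -
    have "0 \<le> (f i - f j) * (f i ^ n - f j ^ n)"
      using assms[OF that(1)] assms[OF that(2)]
      by (cases "f i \<le> f j")
         (auto intro!: mult_nonneg_nonneg mult_nonpos_nonpos simp: power_mono)
    thus ?thesis by (simp add: algebra_simps)
  qed
  have "2 * ((\<Sum>i\<in>I. f i) * (\<Sum>i\<in>I. f i ^ n))
      = (\<Sum>i\<in>I. \<Sum>j\<in>I. f i * f j ^ n) + (\<Sum>i\<in>I. \<Sum>j\<in>I. f j * f i ^ n)"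
    by (subst (2) sum.swap) (simp add: sum_product)
  also have "\<dots> = (\<Sum>i\<in>I. \<Sum>j\<in>I. f i * f j ^ n + f j * f i ^ n)"
    by (simp add: sum.distrib)
  also have "\<dots> \<le> (\<Sum>i\<in>I. \<Sum>j\<in>I. f i ^ Suc n + f j ^ Suc n)"
    by (intro sum_mono swap)
  also have "\<dots> = 2 * (real (card I) * (\<Sum>i\<in>I. f i ^ Suc n))"
    by (simp add: sum.distrib sum_distrib_left)
  finally show ?thesis by simp
qed

text \<open>The power mean inequality, by iterating Chebyshev. \<open>N\<close> is only an upper
  bound for the number of terms, so that it can be a power of the degree bound \<open>D\<close>
  later.\<close>

lemma power_sum_le:
  fixes f :: "'a \<Rightarrow> real"
  assumes "\<And>i. i \<in> I \<Longrightarrow> 0 \<le> f i" "real (card I) \<le> N" "p > 0"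
  shows "(\<Sum>i\<in>I. f i) ^ p \<le> N ^ (p - 1) * (\<Sum>i\<in>I. f i ^ p)"
proof -
  have N: "0 \<le> N" using assms(2) by (meson of_nat_0_le_iff order_trans)
  have "(\<Sum>i\<in>I. f i) ^ Suc n \<le> N ^ n * (\<Sum>i\<in>I. f i ^ Suc n)" for n
  proof (induction n)
    case (Suc n)
    have "(\<Sum>i\<in>I. f i) ^ Suc (Suc n) \<le> (\<Sum>i\<in>I. f i) * (N ^ n * (\<Sum>i\<in>I. f i ^ Suc n))"
      using Suc assms(1) by (subst power_Suc, intro mult_left_mono) (auto intro: sum_nonneg)
    also have "\<dots> = N ^ n * ((\<Sum>i\<in>I. f i) * (\<Sum>i\<in>I. f i ^ Suc n))" by (simp add: mult_ac)
    also have "\<dots> \<le> N ^ n * (real (card I) * (\<Sum>i\<in>I. f i ^ Suc (Suc n)))"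
      using sum_mult_sum_power_le[of I f "Suc n"] assms(1) N by (intro mult_left_mono) auto
    also have "\<dots> \<le> N ^ n * (N * (\<Sum>i\<in>I. f i ^ Suc (Suc n)))"
      using assms(1,2) N by (intro mult_left_mono mult_right_mono sum_nonneg) auto
    finally show ?case by (simp add: mult_ac)
  qed simp
  from this[of "p - 1"] assms(3) show ?thesis by simp
qed

section \<open>Ordered vertex arrays and blow-ups\<close>

definition lists_over :: "'a set \<Rightarrow> nat \<Rightarrow> 'a list set" where
  "lists_over Y n = {ys. set ys \<subseteq> Y \<and> length ys = n}"

lemma finite_lists_over [simp]: "finite Y \<Longrightarrow> finite (lists_over Y n)"
  by (simp add: lists_over_def finite_lists_length_eq)

lemma card_lists_over: "finite Y \<Longrightarrow> card (lists_over Y n) = card Y ^ n"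
  by (simp add: lists_over_def card_lists_length_eq)

definition array_lists :: "nat list \<Rightarrow> 'a set \<Rightarrow> 'a list list set" where
  "array_lists ss Y = {yss. map length yss = ss \<and> (\<forall>ys\<in>set yss. set ys \<subseteq> Y)}"

lemma array_lists_Nil [simp]: "array_lists [] Y = {[]}"
  by (auto simp: array_lists_def)

lemma array_lists_Cons:
  "array_lists (s # ss) Y = (\<lambda>(ys, yss). ys # yss) ` (lists_over Y s \<times> array_lists ss Y)"
  by (fastforce simp: array_lists_def lists_over_def map_eq_Cons_conv image_iff)

lemma finite_array_lists [simp]: "finite Y \<Longrightarrow> finite (array_lists ss Y)"
  by (induction ss) (auto simp: array_lists_Cons)

lemma inj_on_Cons_pair: "inj_on (\<lambda>(ys, yss). ys # yss) S"
  by (auto simp: inj_on_def)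

lemma card_array_lists: "finite Y \<Longrightarrow> card (array_lists ss Y) = card Y ^ sum_list ss"
  by (induction ss)
     (auto simp: array_lists_Cons card_image inj_on_Cons_pair card_cartesian_product
        card_lists_over power_add)

text \<open>
  A set \<open>E\<close> of lists of length \<open>k\<close> is a \<open>k\<close>-partite hypergraph; \<^const>\<open>listset\<close> yields the
  transversals of the parts. Vertices may repeat within a part, so these are homomorphic
  blow-ups.
\<close>

definition blowups :: "nat list \<Rightarrow> 'a set \<Rightarrow> 'a list set \<Rightarrow> 'a list list set" where
  "blowups ss Y E = {yss \<in> array_lists ss Y. listset (map set yss) \<subseteq> E}"

text \<open>The recursion behind the induction of Erdos: once the first part \<open>ys\<close> is
  fixed, the other parts form a blow-up in the common link of its vertices.\<close>

lemma blowups_Cons: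
  "blowups (s # ss) Y E = (\<lambda>(ys, yss). ys # yss) `
     (SIGMA ys:lists_over Y s. blowups ss Y {l. \<forall>y\<in>set ys. y # l \<in> E})"
  by (auto simp: blowups_def array_lists_Cons set_Cons_def image_iff) blast+

lemma card_pairs_swap:
  assumes "finite A" "finite B"
  shows "(\<Sum>x\<in>A. card {y \<in> B. R x y}) = (\<Sum>y\<in>B. card {x \<in> A. R x y})"
  using sum.swap_restrict[OF assms, of "\<lambda>_ _. 1::nat" R] by simp

text \<open>With \<open>k = length ss\<close>, \<open>p = prod_list ss\<close> and
  \<open>D > 0\<close>, this says that blow-ups have density at least the \<open>p\<close>-th power
  of the density of \<open>E\<close> in \<open>D ^ k\<close>. It is the count of Erdos, by induction
  on the number of parts; the form without division also covers \<open>D = 0\<close>.\<close>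

lemma card_blowups_lower_bound:
  assumes "finite Y" "real (card Y) \<le> D" "\<forall>s\<in>set ss. s > 0" "E \<subseteq> lists_over Y (length ss)"
  shows "real (card E) ^ prod_list ss * D ^ sum_list ss
           \<le> real (card (blowups ss Y E)) * D ^ (length ss * prod_list ss)"
  using assms(3,4)
proof (induction ss arbitrary: E)
  case Nil
  have B: "blowups [] Y {[]} = {[]}" by (auto simp: blowups_def)
  from Nil consider "E = {}" | "E = {[]}" by (auto simp: lists_over_def)
  thus ?case
  proof cases
    case 2
    show ?thesis unfolding 2 B by simp
  qed simp
next
  case (Cons s ss)
  define k p S where "k = length ss" and "p = prod_list ss" and "S = sum_list ss"
  \<comment> \<open>\<open>E' ys\<close> is the common link of a candidate first part
    \<open>ys\<close> in \<open>L\<close>; \<open>c l\<close> counts the vertices that extend the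
    tail \<open>l\<close> in \<open>M\<close>.\<close>
  define E' where "E' = (\<lambda>ys. {l. \<forall>y\<in>set ys. y # l \<in> E})"
  define L where "L = lists_over Y s"
  define M where "M = lists_over Y k"
  define c where "c = (\<lambda>l. card {y. y # l \<in> E})"
  have s: "s > 0" and ss: "\<forall>s\<in>set ss. s > 0" using Cons.prems(1) by auto
  have p: "p > 0" using ss unfolding p_def by (induction ss) auto
  have D: "D \<ge> 0" using assms(2) by linarith
  have fin: "finite L" "finite M" using assms(1) by (auto simp: L_def M_def)
  have cardL: "real (card L) \<le> D ^ s" and cardM: "real (card M) \<le> D ^ k"
    using assms(1,2) by (auto simp: L_def M_def card_lists_over intro!: power_mono)
  have EY: "y \<in> Y" "l \<in> M" if "y # l \<in> E" for y l
    using subsetD[OF Cons.prems(2) that] by (auto simp: lists_over_def M_def k_def)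
  \<comment> \<open>Positivity of \<open>s\<close> matters: the common link of the empty list would
    be the set of all lists.\<close>
  have E'M: "E' ys \<subseteq> M" if "ys \<in> L" for ys
  proof -
    have "ys \<noteq> []" using that s by (auto simp: L_def lists_over_def)
    thus ?thesis using EY by (cases ys) (auto simp: E'_def)
  qed
  have IH: "real (card (E' ys)) ^ p * D ^ S \<le> real (card (blowups ss Y (E' ys))) * D ^ (k * p)"
    if "ys \<in> L" for ys
    unfolding k_def p_def S_def
    by (rule Cons.IH[OF ss]) (use E'M[OF that] in \<open>simp only: M_def k_def\<close>)
  have "(\<lambda>(l, y). y # l) ` (SIGMA l:M. {y. y # l \<in> E}) = E"
  proof (intro equalityI subsetI)
    fix x assume x: "x \<in> E"
    then obtain y l where "x = y # l"
      using Cons.prems(2) by (cases x) (auto simp: lists_over_def)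
    with x EY show "x \<in> (\<lambda>(l, y). y # l) ` (SIGMA l:M. {y. y # l \<in> E})"
      by (auto simp: image_iff)
  qed auto
  moreover have "inj_on (\<lambda>(l, y). y # l) (SIGMA l:M. {y. y # l \<in> E})"
    by (auto simp: inj_on_def)
  ultimately have "card E = card (SIGMA l:M. {y. y # l \<in> E})"
    by (metis card_image)
  moreover have finc: "finite {y. y # l \<in> E}" for l
    by (rule finite_subset[OF _ assms(1)]) (use EY in auto)
  ultimately have cardE: "card E = (\<Sum>l\<in>M. c l)"
    using fin by (simp add: c_def)
  \<comment> \<open>Double counting of pairs \<open>(ys, l)\<close> in which every entry of
    \<open>ys\<close> extends \<open>l\<close>; a tail \<open>l\<close> lies in
    \<open>c l ^ s\<close> of them.\<close>
  have "(\<Sum>ys\<in>L. card (E' ys)) = (\<Sum>ys\<in>L. card {l \<in> M. \<forall>y\<in>set ys. y # l \<in> E})"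
  proof (intro sum.cong refl arg_cong[where f = card])
    fix ys assume "ys \<in> L"
    show "E' ys = {l \<in> M. \<forall>y\<in>set ys. y # l \<in> E}" using E'M[OF \<open>ys \<in> L\<close>] by (auto simp: E'_def)
  qed
  also have "\<dots> = (\<Sum>l\<in>M. card {ys \<in> L. \<forall>y\<in>set ys. y # l \<in> E})"
    by (rule card_pairs_swap[OF fin])
  also have "\<dots> = (\<Sum>l\<in>M. c l ^ s)"
  proof (intro sum.cong refl)
    fix l assume "l \<in> M"
    have "{ys \<in> L. \<forall>y\<in>set ys. y # l \<in> E} = lists_over {y. y # l \<in> E} s"
      using EY by (auto simp: L_def lists_over_def)
    thus "card {ys \<in> L. \<forall>y\<in>set ys. y # l \<in> E} = c l ^ s"
      using finc by (simp add: card_lists_over c_def)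
  qed
  finally have sumE': "(\<Sum>ys\<in>L. real (card (E' ys))) = (\<Sum>l\<in>M. real (c l) ^ s)"
    by (simp flip: of_nat_sum of_nat_power)
  \<comment> \<open>First power mean, over the at most \<open>D ^ k\<close> tails; a second one,
    over the at most \<open>D ^ s\<close> first parts, prepares for the induction hypothesis on each
    \<open>E' ys\<close>.\<close>
  have "real (card E) ^ s \<le> (D ^ k) ^ (s - 1) * (\<Sum>l\<in>M. real (c l) ^ s)"
    unfolding cardE of_nat_sum by (rule power_sum_le[OF _ cardM s]) simp
  hence "(real (card E) ^ s) ^ p \<le> ((D ^ k) ^ (s - 1) * (\<Sum>ys\<in>L. real (card (E' ys)))) ^ p"
    unfolding sumE' by (intro power_mono) auto
  also have "\<dots> = (D ^ k) ^ ((s - 1) * p) * (\<Sum>ys\<in>L. real (card (E' ys))) ^ p"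
    by (simp add: power_mult_distrib power_mult)
  also have "\<dots> \<le> (D ^ k) ^ ((s - 1) * p) * ((D ^ s) ^ (p - 1) * (\<Sum>ys\<in>L. real (card (E' ys)) ^ p))"
    by (intro mult_left_mono power_sum_le cardL p) (use D in auto)
  finally have "(real (card E) ^ s) ^ p * D ^ (s + S) \<le>
      (D ^ k) ^ ((s - 1) * p) * ((D ^ s) ^ (p - 1) * (\<Sum>ys\<in>L. real (card (E' ys)) ^ p)) * D ^ (s + S)"
    by (rule mult_right_mono) (use D in simp)
  also have "\<dots> = (D ^ k) ^ ((s - 1) * p) * ((D ^ s) ^ (p - 1) * D ^ s) *
      (\<Sum>ys\<in>L. real (card (E' ys)) ^ p * D ^ S)"
    unfolding sum_distrib_right[symmetric] by (simp add: power_add mult_ac)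
  also have "\<dots> \<le> (D ^ k) ^ ((s - 1) * p) * ((D ^ s) ^ (p - 1) * D ^ s) *
      (\<Sum>ys\<in>L. real (card (blowups ss Y (E' ys))) * D ^ (k * p))"
    by (intro mult_left_mono sum_mono IH) (use D in auto)
  also have "\<dots> = ((D ^ k) ^ ((s - 1) * p) * D ^ (k * p)) * ((D ^ s) ^ (p - 1) * D ^ s) *
      (\<Sum>ys\<in>L. real (card (blowups ss Y (E' ys))))"
    unfolding sum_distrib_right[symmetric] by (simp add: mult_ac)
  also have "(D ^ k) ^ ((s - 1) * p) * D ^ (k * p) = D ^ (k * (s * p))"
    using s by (cases s) (simp_all add: algebra_simps flip: power_mult power_add)
  also have "(D ^ s) ^ (p - 1) * D ^ s = D ^ (s * p)"
    using p by (cases p) (simp_all add: algebra_simps flip: power_mult power_add)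
  also have "D ^ (k * (s * p)) * D ^ (s * p) = D ^ (k * (s * p) + s * p)"
    by (simp only: power_add)
  also have "k * (s * p) + s * p = length (s # ss) * prod_list (s # ss)"
    by (simp add: k_def p_def)
  also have "(\<Sum>ys\<in>L. real (card (blowups ss Y (E' ys)))) = real (card (blowups (s # ss) Y E))"
  proof -
    have "finite (blowups ss Y (E' ys))" for ys
      using assms(1) by (simp add: blowups_def)
    hence "card (blowups (s # ss) Y E) = (\<Sum>ys\<in>L. card (blowups ss Y (E' ys)))"
      unfolding blowups_Cons card_image[OF inj_on_Cons_pair] E'_def[symmetric]
      using fin by (simp add: L_def E'_def)
    thus ?thesis by simp
  qed
  finally show ?case
    by (simp only: p_def S_def power_mult prod_list.Cons sum_list.Cons mult.commute)
qed

section \<open>Arrays with a repetition or with two related entries\<close>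

text \<open>A repetition lies in the tail or involves the head, and saves one factor
  \<open>card Y\<close>. The square is a crude constant that survives the induction because
  \<open>n\<^sup>2 + n\<close> is at most \<open>(n + 1)\<^sup>2\<close>.\<close>

lemma card_nondistinct_lists_over:
  assumes "finite Y"
  shows "card {l \<in> lists_over Y n. \<not> distinct l} \<le> n\<^sup>2 * card Y ^ (n - 1)"
proof (induction n)
  case 0
  have "{l \<in> lists_over Y 0. \<not> distinct l} = {}" by (auto simp: lists_over_def)
  thus ?case by (simp only: card.empty)
next
  case (Suc n)
  let ?B = "{l \<in> lists_over Y n. \<not> distinct l}"
  let ?C = "(\<lambda>(y, l). y # l) ` (Y \<times> ?B)"
  let ?R = "(\<lambda>(l, y). y # l) ` (SIGMA l:lists_over Y n. set l)"
  have "{l \<in> lists_over Y (Suc n). \<not> distinct l} \<subseteq> ?C \<union> ?R"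
  proof
    fix l assume "l \<in> {l \<in> lists_over Y (Suc n). \<not> distinct l}"
    then obtain y ys where "l = y # ys" "y \<in> Y" "ys \<in> lists_over Y n" "\<not> distinct ys \<or> y \<in> set ys"
      by (auto simp: lists_over_def length_Suc_conv)
    thus "l \<in> ?C \<union> ?R" by (auto simp: image_iff)
  qed
  moreover have finC: "finite ?C" "finite ?R" using assms by auto
  ultimately have "card {l \<in> lists_over Y (Suc n). \<not> distinct l} \<le> card (?C \<union> ?R)"
    by (intro card_mono) auto
  also have "\<dots> \<le> card ?C + card ?R" by (rule card_Un_le)
  also have "card ?C \<le> card Y * card ?B"
    using card_image_le[of "Y \<times> ?B" "\<lambda>(y, l). y # l"] assms by (simp add: card_cartesian_product)
  also have "\<dots> \<le> card Y * (n\<^sup>2 * card Y ^ (n - 1))"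
    using Suc by (rule mult_left_mono) simp
  also have "\<dots> \<le> n\<^sup>2 * card Y ^ n"
    by (cases n) auto
  also have "card ?R \<le> card (SIGMA l:lists_over Y n. set l)"
    using assms by (intro card_image_le) auto
  also have "\<dots> = (\<Sum>l\<in>lists_over Y n. card (set l))"
    using assms by simp
  also have "\<dots> \<le> (\<Sum>l\<in>lists_over Y n. n)"
    by (intro sum_mono) (auto simp: lists_over_def card_length)
  also have "\<dots> = n * card Y ^ n"
    using assms by (simp add: card_lists_over)
  also have "n\<^sup>2 * card Y ^ n + n * card Y ^ n \<le> (Suc n)\<^sup>2 * card Y ^ n"
    by (simp add: power2_eq_square algebra_simps)
  finally show ?case by simp
qed

text \<open>The lengths in \<open>ss\<close> tell where to cut the concatenation, so repetitions in
  arrays can be counted as repetitions in flat lists.\<close>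

lemma inj_on_concat_array_lists: "inj_on concat (array_lists ss Y)"
proof (induction ss)
  case (Cons s ss)
  thus ?case
    by (auto simp: inj_on_def array_lists_Cons lists_over_def)
qed (simp add: inj_on_def)

lemma card_nondistinct_array_lists:
  assumes "finite Y"
  shows "card {yss \<in> array_lists ss Y. \<not> distinct (concat yss)}
           \<le> (sum_list ss)\<^sup>2 * card Y ^ (sum_list ss - 1)"
proof -
  have "card {yss \<in> array_lists ss Y. \<not> distinct (concat yss)}
      \<le> card {l \<in> lists_over Y (sum_list ss). \<not> distinct l}"
  proof (rule card_inj_on_le[of concat])
    show "inj_on concat {yss \<in> array_lists ss Y. \<not> distinct (concat yss)}"
      by (rule inj_on_subset[OF inj_on_concat_array_lists]) auto
    show "concat ` {yss \<in> array_lists ss Y. \<not> distinct (concat yss)}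
        \<subseteq> {l \<in> lists_over Y (sum_list ss). \<not> distinct l}"
      by (fastforce simp: array_lists_def lists_over_def length_concat)
  qed (use assms in auto)
  also note card_nondistinct_lists_over[OF assms]
  finally show ?thesis .
qed

text \<open>The first entries of the first two lists are chosen together as a related pair, all
  remaining entries freely.\<close>

lemma card_array_lists_hd_related:
  assumes "finite W" "s1 > 0" "s2 > 0"
  shows "card {yss \<in> array_lists (s1 # s2 # ss) W. R (hd (yss ! 0)) (hd (yss ! 1))}
     \<le> card {(u, v). u \<in> W \<and> v \<in> W \<and> R u v} * card W ^ (s1 + s2 + sum_list ss - 2)"
proof -
  let ?P = "{(u, v). u \<in> W \<and> v \<in> W \<and> R u v}"
  let ?f = "\<lambda>((u, v), us, vs, yss). (u # us) # (v # vs) # yss"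
  let ?Q = "?P \<times> lists_over W (s1 - 1) \<times> lists_over W (s2 - 1) \<times> array_lists ss W"
  have finP: "finite ?P" by (rule finite_subset[of _ "W \<times> W"]) (use assms in auto)
  have "{yss \<in> array_lists (s1 # s2 # ss) W. R (hd (yss ! 0)) (hd (yss ! 1))} \<subseteq> ?f ` ?Q"
  proof
    fix yss assume "yss \<in> {yss \<in> array_lists (s1 # s2 # ss) W. R (hd (yss ! 0)) (hd (yss ! 1))}"
    then obtain ys zs xss where *: "yss = ys # zs # xss" "ys \<in> lists_over W s1" "zs \<in> lists_over W s2"
      "xss \<in> array_lists ss W" "R (hd ys) (hd zs)"
      by (auto simp: array_lists_Cons)
    moreover obtain u us v vs where "ys = u # us" "zs = v # vs"
      using * assms(2,3) by (cases ys; cases zs) (auto simp: lists_over_def)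
    ultimately have "yss = ?f ((u, v), us, vs, xss)" "((u, v), us, vs, xss) \<in> ?Q"
      by (auto simp: lists_over_def)
    thus "yss \<in> ?f ` ?Q" by blast
  qed
  hence "card {yss \<in> array_lists (s1 # s2 # ss) W. R (hd (yss ! 0)) (hd (yss ! 1))} \<le> card (?f ` ?Q)"
    using assms finP by (intro card_mono) auto
  also have "\<dots> \<le> card ?Q"
    using assms finP by (intro card_image_le) auto
  also have "\<dots> = card ?P * (card W ^ (s1 - 1) * card W ^ (s2 - 1) * card W ^ sum_list ss)"
    using assms by (simp add: card_cartesian_product card_lists_over card_array_lists mult.assoc)
  also have "card W ^ (s1 - 1) * card W ^ (s2 - 1) * card W ^ sum_list ss
      = card W ^ ((s1 - 1) + (s2 - 1) + sum_list ss)"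
    by (simp only: power_add)
  also have "(s1 - 1) + (s2 - 1) + sum_list ss = s1 + s2 + sum_list ss - 2"
    using assms by simp
  finally show ?thesis .
qed


section \<open>Rooted cliques\<close>

text \<open>Lists instead of sets, so that the cliques form a hypergraph to which
  \<open>blowups\<close> applies. For symmetric irreflexive \<open>adj\<close> every clique occurs
  once in each order.\<close>

definition clique_lists :: "('a \<Rightarrow> 'a \<Rightarrow> bool) \<Rightarrow> 'a set \<Rightarrow> nat \<Rightarrow> 'a list set" where
  "clique_lists adj W k = {ys \<in> lists_over W k. sorted_wrt adj ys}"

definition link :: "('a \<Rightarrow> 'a \<Rightarrow> bool) \<Rightarrow> 'a set \<Rightarrow> 'a \<Rightarrow> 'a set" where
  "link adj W x = {y \<in> W. adj x y}"

lemma finite_link [simp]: "finite W \<Longrightarrow> finite (link adj W x)"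
  by (simp add: link_def)

lemma finite_clique_lists [simp]: "finite W \<Longrightarrow> finite (clique_lists adj W k)"
  by (simp add: clique_lists_def)

section \<open>Transversals of nonempty parts\<close>

lemma map_hd_in_listset: "\<forall>ys\<in>set yss. ys \<noteq> [] \<Longrightarrow> map hd yss \<in> listset (map set yss)"
  by (induction yss) (auto simp: set_Cons_def)

lemma ex_listset_through:
  "\<forall>A\<in>set As. A \<noteq> {} \<Longrightarrow> B \<in> set As \<Longrightarrow> b \<in> B \<Longrightarrow> \<exists>l\<in>listset As. b \<in> set l"
proof (induction As)
  case (Cons A As)
  have ne: "listset As \<noteq> {}" using Cons.prems(1) by (induction As) (auto simp: set_Cons_def)
  show ?case
  proof (cases "B = A")
    case True
    with ne Cons.prems(3) obtain l where "l \<in> listset As" by blast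
    hence "b # l \<in> listset (A # As)" using True Cons.prems(3) by (auto simp: set_Cons_def)
    thus ?thesis by (rule rev_bexI) simp
  next
    case False
    then obtain l where l: "l \<in> listset As" "b \<in> set l" using Cons by auto
    obtain a where "a \<in> A" using Cons.prems(1) by auto
    with l have "a # l \<in> listset (A # As)" by (auto simp: set_Cons_def)
    thus ?thesis by (rule rev_bexI) (simp add: l)
  qed
qed simp

text \<open>Elements of two different parts lie on a common transversal. An empty part would leave
  no transversal and make the second premise vacuous.\<close>

lemma sorted_wrt_of_listset:
  "\<lbrakk>\<forall>A\<in>set As. A \<noteq> {}; \<forall>l\<in>listset As. sorted_wrt P l\<rbrakk>
     \<Longrightarrow> sorted_wrt (\<lambda>A B. \<forall>a\<in>A. \<forall>b\<in>B. P a b) As"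
proof (induction As)
  case (Cons A As)
  have P: "sorted_wrt P (a # l)" if "a \<in> A" "l \<in> listset As" for a l
    by (rule bspec[OF Cons.prems(2)]) (use that in \<open>auto simp: set_Cons_def\<close>)
  have "P a b" if B: "B \<in> set As" "b \<in> B" and a: "a \<in> A" for B a b
  proof -
    obtain l where "l \<in> listset As" "b \<in> set l"
      using ex_listset_through[OF _ B] Cons.prems(1) by force
    thus ?thesis using P[OF a] by auto
  qed
  moreover obtain a where "a \<in> A" using Cons.prems(1) by auto
  hence "\<forall>l\<in>listset As. sorted_wrt P l" using P by auto
  ultimately show ?case using Cons by auto
qed simp

text \<open>
  The factor \<open>q h\<^bsup>S-2\<^esup>\<close> uses that the first vertices of the first two parts are adjacent; the
  trivial factor \<open>h\<^sup>S\<close> would lose too much when all parts but the last are singletons.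
\<close>

lemma rooted_clique_lists_bound:
  fixes adj :: "'a \<Rightarrow> 'a \<Rightarrow> bool"
  assumes fin: "finite A" "finite W"
    and ss: "ss = s1 # s2 # ss'" "\<forall>s\<in>set ss. s > 0"
    and deg: "\<And>x. x \<in> A \<Longrightarrow> real (card (link adj W x)) \<le> D"
    and A: "real (card A) \<le> n" and W: "real (card W) \<le> h"
    and q: "real (card {(u, v). u \<in> W \<and> v \<in> W \<and> adj u v}) \<le> q"
    and few: "\<And>yss. \<lbrakk>yss \<in> array_lists ss W; distinct (concat yss)\<rbrakk> \<Longrightarrow>
        card {x \<in> A. listset (map set yss) \<subseteq> clique_lists adj (link adj W x) (length ss)} \<le> t"
    and D: "D > 0"
  shows "real (\<Sum>x\<in>A. card (clique_lists adj (link adj W x) (length ss))) ^ prod_list ss * D ^ sum_list ss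
    \<le> D ^ (length ss * prod_list ss) * n ^ (prod_list ss - 1) *
        (real t * (q * h ^ (sum_list ss - 2)) + real ((sum_list ss)\<^sup>2) * n * D ^ (sum_list ss - 1))"
proof -
  define k p S where "k = length ss" and "p = prod_list ss" and "S = sum_list ss"
  define E where "E = (\<lambda>x. clique_lists adj (link adj W x) k)"
  define B where "B = (\<lambda>x. blowups ss (link adj W x) (E x))"
  define bad where "bad = (\<lambda>x. {yss \<in> array_lists ss (link adj W x). \<not> distinct (concat yss)})"
  define M where "M = {yss \<in> array_lists ss W. adj (hd (yss ! 0)) (hd (yss ! 1))}"
  define M' where "M' = {yss \<in> M. distinct (concat yss)}"
  have n0: "n \<ge> 0" and h0: "h \<ge> 0" and q0: "q \<ge> 0" using A W q by linarith+
  have p: "p > 0" using ss(2) unfolding p_def by (induction ss) auto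
  have finM: "finite M" "finite M'" using fin by (auto simp: M_def M'_def)
  have cardM': "real (card M') \<le> q * h ^ (S - 2)"
  proof -
    have "card M \<le> card {(u, v). u \<in> W \<and> v \<in> W \<and> adj u v} * card W ^ (S - 2)"
      using card_array_lists_hd_related[of W s1 s2 ss' adj] fin(2) ss
      by (simp add: M_def S_def add.assoc)
    moreover have "card M' \<le> card M" using finM by (intro card_mono) (auto simp: M'_def)
    ultimately have "real (card M') \<le> real (card {(u, v). u \<in> W \<and> v \<in> W \<and> adj u v} * card W ^ (S - 2))"
      by linarith
    also have "\<dots> = real (card {(u, v). u \<in> W \<and> v \<in> W \<and> adj u v}) * real (card W) ^ (S - 2)"
      by simp
    also have "\<dots> \<le> q * h ^ (S - 2)"
      using q W q0 by (intro mult_mono power_mono) auto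
    finally show ?thesis .
  qed
  \<comment> \<open>The list of first entries is itself a transversal, hence a clique, so the first
    two heads are adjacent. Blow-ups with a repeated vertex go to \<open>bad x\<close>.\<close>
  have Bsub: "B x \<subseteq> bad x \<union> {yss \<in> M'. listset (map set yss) \<subseteq> E x}" for x
  proof
    fix yss assume yss: "yss \<in> B x"
    hence arr: "yss \<in> array_lists ss (link adj W x)" and sub: "listset (map set yss) \<subseteq> E x"
      by (auto simp: B_def blowups_def)
    have len: "map length yss = ss" using arr by (simp add: array_lists_def)
    have "\<forall>ys\<in>set yss. ys \<noteq> []" using ss(2) unfolding len[symmetric] by auto
    hence "map hd yss \<in> E x" using map_hd_in_listset[of yss] sub by blast
    hence "sorted_wrt adj (map hd yss)" by (simp add: E_def clique_lists_def)
    moreover obtain ys zs yss' where "yss = ys # zs # yss'"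
      using len ss(1) by (auto simp: map_eq_Cons_conv)
    ultimately have "adj (hd (yss ! 0)) (hd (yss ! 1))" by simp
    moreover have "yss \<in> array_lists ss W"
      using arr by (auto simp: array_lists_def link_def)
    ultimately show "yss \<in> bad x \<union> {yss \<in> M'. listset (map set yss) \<subseteq> E x}"
      using arr sub by (auto simp: bad_def M'_def M_def)
  qed
  have cardbad: "real (card (bad x)) \<le> real (S\<^sup>2) * D ^ (S - 1)" if "x \<in> A" for x
  proof -
    have "real (card (bad x)) \<le> real (S\<^sup>2 * card (link adj W x) ^ (S - 1))"
      using card_nondistinct_array_lists[of "link adj W x" ss] fin
      unfolding bad_def S_def of_nat_le_iff by simp
    also have "\<dots> = real (S\<^sup>2) * real (card (link adj W x)) ^ (S - 1)" by simp
    also have "\<dots> \<le> real (S\<^sup>2) * D ^ (S - 1)"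
      using deg[OF that] by (intro mult_left_mono power_mono) auto
    finally show ?thesis .
  qed
  have "(\<Sum>x\<in>A. real (card (B x)))
      \<le> (\<Sum>x\<in>A. real (card (bad x)) + real (card {yss \<in> M'. listset (map set yss) \<subseteq> E x}))"
  proof (intro sum_mono)
    fix x
    have "finite (bad x)" using fin by (simp add: bad_def)
    hence "card (B x) \<le> card (bad x \<union> {yss \<in> M'. listset (map set yss) \<subseteq> E x})"
      using Bsub finM by (intro card_mono) auto
    also have "\<dots> \<le> card (bad x) + card {yss \<in> M'. listset (map set yss) \<subseteq> E x}"
      by (rule card_Un_le)
    finally show "real (card (B x)) \<le> real (card (bad x)) + real (card {yss \<in> M'. listset (map set yss) \<subseteq> E x})"
      by linarith
  qed
  also have "\<dots> = (\<Sum>x\<in>A. real (card (bad x))) + (\<Sum>x\<in>A. real (card {yss \<in> M'. listset (map set yss) \<subseteq> E x}))"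
    by (rule sum.distrib)
  also have "(\<Sum>x\<in>A. real (card (bad x))) \<le> real (card A) * (real (S\<^sup>2) * D ^ (S - 1))"
    by (rule sum_bounded_above[OF cardbad])
  also have "\<dots> \<le> n * (real (S\<^sup>2) * D ^ (S - 1))"
    using A D by (intro mult_right_mono) auto
  \<comment> \<open>Double counting of roots against arrays with distinct entries, each of which is
    shared by at most \<open>t\<close> roots.\<close>
  also have "(\<Sum>x\<in>A. real (card {yss \<in> M'. listset (map set yss) \<subseteq> E x}))
      = (\<Sum>yss\<in>M'. real (card {x \<in> A. listset (map set yss) \<subseteq> E x}))"
    using card_pairs_swap[OF fin(1) finM(2), of "\<lambda>x yss. listset (map set yss) \<subseteq> E x"]
    by (simp flip: of_nat_sum)
  also have "\<dots> \<le> real (card M') * real t"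
  proof (rule sum_bounded_above)
    fix yss assume "yss \<in> M'"
    hence "yss \<in> array_lists ss W" "distinct (concat yss)" by (auto simp: M'_def M_def)
    from few[OF this] show "real (card {x \<in> A. listset (map set yss) \<subseteq> E x}) \<le> real t"
      by (simp add: E_def k_def)
  qed
  also have "\<dots> \<le> q * h ^ (S - 2) * real t"
    using cardM' by (rule mult_right_mono) simp
  finally have sumB: "(\<Sum>x\<in>A. real (card (B x)))
      \<le> real t * (q * h ^ (S - 2)) + real (S\<^sup>2) * n * D ^ (S - 1)"
    by (simp add: mult_ac)
  \<comment> \<open>A power mean over the roots, after which the count of blow-ups is applied inside
    each link; comparison with \<open>sumB\<close> finishes the proof.\<close>
  have "real (\<Sum>x\<in>A. card (E x)) ^ p * D ^ S \<le> n ^ (p - 1) * (\<Sum>x\<in>A. real (card (E x)) ^ p) * D ^ S"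
    unfolding of_nat_sum using D by (intro mult_right_mono power_sum_le A p) auto
  also have "\<dots> = n ^ (p - 1) * (\<Sum>x\<in>A. real (card (E x)) ^ p * D ^ S)"
    by (simp add: sum_distrib_right)
  also have "\<dots> \<le> n ^ (p - 1) * (\<Sum>x\<in>A. real (card (B x)) * D ^ (k * p))"
  proof (intro mult_left_mono sum_mono)
    fix x assume "x \<in> A"
    show "real (card (E x)) ^ p * D ^ S \<le> real (card (B x)) * D ^ (k * p)"
      unfolding B_def p_def S_def k_def
      by (rule card_blowups_lower_bound[OF _ deg[OF \<open>x \<in> A\<close>] ss(2)])
         (use fin in \<open>auto simp: E_def clique_lists_def k_def\<close>)
  qed (use n0 in simp)
  also have "\<dots> = D ^ (k * p) * n ^ (p - 1) * (\<Sum>x\<in>A. real (card (B x)))"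
    by (simp add: mult_ac flip: sum_distrib_right)
  also have "\<dots> \<le> D ^ (k * p) * n ^ (p - 1) * (real t * (q * h ^ (S - 2)) + real (S\<^sup>2) * n * D ^ (S - 1))"
    using D n0 by (intro mult_left_mono sumB) auto
  finally show ?thesis
    by (simp only: E_def k_def p_def S_def)
qed

section \<open>Finding the forbidden graph\<close>

text \<open>The vertex \<open>(i, j)\<close> is sent to entry \<open>j\<close> of list
  \<open>i\<close>. Vertices of different parts have different images because an edge has two
  elements; within a part, distinctness of the list is used.\<close>

lemma complete_multipartite_not_free:
  assumes G: "simple_graph G"
    and len: "map length yss = map s [1..<Suc r]"
    and V: "\<forall>ys\<in>set yss. set ys \<subseteq> verts G"
    and dist: "\<forall>ys\<in>set yss. distinct ys"
    and adj: "sorted_wrt (\<lambda>A B. \<forall>a\<in>A. \<forall>b\<in>B. {a, b} \<in> edges G) (map set yss)"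
  shows "\<not> free_of (complete_multipartite r s) G"
proof -
  \<comment> \<open>Parts and their vertices are numbered from 1, list positions from 0.\<close>
  define f where "f = (\<lambda>(i, j). yss ! (i - 1) ! (j - 1))"
  define U where "U = (SIGMA i:{1..r}. {1..s i})"
  define F where "F = {{x, y} | x y. x \<in> U \<and> y \<in> U \<and> fst x \<noteq> fst y}"
  have CM: "complete_multipartite r s = (U, F)"
    by (simp add: complete_multipartite_def U_def F_def Let_def)
  have lenyss: "length yss = r" using arg_cong[OF len, of length] by simp
  have leni: "length (yss ! i) = s (Suc i)" if "i < r" for i
  proof -
    have "map length yss ! i = map s [1..<Suc r] ! i" using len by simp
    thus ?thesis using that lenyss by (simp del: upt_Suc)
  qed
  have mem: "f (i, j) \<in> set (yss ! (i - 1))" "yss ! (i - 1) \<in> set yss" "i - 1 < r"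
    if "(i, j) \<in> U" for i j
    using that leni[of "i - 1"] lenyss by (auto simp: f_def U_def intro!: nth_mem)
  have e1: "{f (i, j), f (i', j')} \<in> edges G" if "(i, j) \<in> U" "(i', j') \<in> U" "i < i'" for i j i' j'
  proof -
    have "i - 1 < i' - 1" using that by (auto simp: U_def)
    thus ?thesis using sorted_wrt_nth_less[OF adj, of "i - 1" "i' - 1"] mem[OF that(1)] mem[OF that(2)] lenyss
      by simp
  qed
  have e2: "{f x, f y} \<in> edges G" if "x \<in> U" "y \<in> U" "fst x \<noteq> fst y" for x y
    using e1[of "fst x" "snd x" "fst y" "snd y"] e1[of "fst y" "snd y" "fst x" "snd x"] that
    by (cases "fst x < fst y") (auto simp: insert_commute)
  have card2: "card {f x, f y} = 2" if "x \<in> U" "y \<in> U" "fst x \<noteq> fst y" for x y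
    using e2[OF that] G by (auto simp: simple_graph_def)
  have inj: "inj_on f U"
  proof (rule inj_onI)
    fix x y assume xy: "x \<in> U" "y \<in> U" "f x = f y"
    obtain i j i' j' where [simp]: "x = (i, j)" "y = (i', j')" by (cases x, cases y)
    have "i = i'" using card2[OF xy(1,2)] xy(3) by (cases "i = i'") auto
    moreover have "j - 1 = j' - 1"
      using dist mem[of i j] xy leni[of "i - 1"] \<open>i = i'\<close>
      by (auto simp: f_def U_def nth_eq_iff_index_eq)
    ultimately show "x = y" using xy by (auto simp: U_def)
  qed
  define H where "H = (f ` U, (\<lambda>e. f ` e) ` F)"
  have FE: "\<exists>x y. e = {x, y} \<and> x \<in> U \<and> y \<in> U \<and> fst x \<noteq> fst y" if "e \<in> F" for e
    using that by (auto simp: F_def)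
  have "f ` e \<subseteq> f ` U \<and> card (f ` e) = 2 \<and> f ` e \<in> edges G" if "e \<in> F" for e
    using FE[OF that] card2 e2 by auto
  moreover have "finite U" by (simp add: U_def)
  moreover have "f ` U \<subseteq> verts G" using mem V by fastforce
  ultimately have "subgraph H G"
    by (auto simp: subgraph_def simple_graph_def H_def)
  moreover have "graph_iso (complete_multipartite r s) H"
    unfolding graph_iso_def CM H_def by (rule exI[of _ f]) (simp add: inj bij_betw_def)
  ultimately have "H \<in> copies (complete_multipartite r s) G" by (simp add: copies_def)
  thus ?thesis by (auto simp: free_of_def)
qed

text \<open>The parts of a shared array are completely joined to each other and to all roots that
  share it, so \<open>s r\<close> such roots would serve as the last part of the forbidden
  graph.\<close>

lemma free_of_few_common_neighbours:
  fixes G :: "'a ugraph"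
  defines "adj \<equiv> \<lambda>u v. {u, v} \<in> edges G"
  assumes G: "simple_graph G" and free: "free_of (complete_multipartite r s) G"
    and r: "r \<ge> 1" and s: "\<forall>i\<in>{1..r}. s i > 0"
    and AW: "A \<subseteq> verts G" "W \<subseteq> verts G"
    and yss: "yss \<in> array_lists (map s [1..<r]) W" "distinct (concat yss)"
  shows "card {x \<in> A. listset (map set yss) \<subseteq> clique_lists adj (link adj W x) k} \<le> s r"
proof (rule ccontr)
  define X where "X = {x \<in> A. listset (map set yss) \<subseteq> clique_lists adj (link adj W x) k}"
  assume "\<not> ?thesis"
  hence "s r \<le> card X" by (simp add: X_def)
  then obtain Z where Z: "Z \<subseteq> X" "card Z = s r" "finite Z"
    by (meson obtain_subset_with_card_n)
  then obtain zs where zs: "set zs = Z" "distinct zs" using finite_distinct_list by blast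
  have len: "map length yss = map s [1..<r]" using yss(1) by (simp add: array_lists_def)
  have "\<forall>n\<in>set (map s [1..<r]). n > 0" using s by auto
  hence ne: "\<forall>ys\<in>set yss. ys \<noteq> []" unfolding len[symmetric] by simp
  hence ne': "\<forall>B\<in>set (map set yss). B \<noteq> {}" by auto
  \<comment> \<open>Transversals are known to be cliques only through some root.\<close>
  have Zne: "Z \<noteq> {}" using Z s r by (metis atLeastAtMost_iff card.empty less_irrefl order_refl)
  have X: "listset (map set yss) \<subseteq> clique_lists adj (link adj W x) k" "x \<in> verts G" if "x \<in> Z" for x
    using that Z AW by (auto simp: X_def)
  have sorted: "sorted_wrt (\<lambda>A B. \<forall>a\<in>A. \<forall>b\<in>B. {a, b} \<in> edges G) (map set yss)"
  proof (rule sorted_wrt_of_listset[OF ne'])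
    show "\<forall>l\<in>listset (map set yss). sorted_wrt (\<lambda>a b. {a, b} \<in> edges G) l"
      using Zne X by (fastforce simp: clique_lists_def adj_def)
  qed
  have adjZ: "{y, z} \<in> edges G" if "z \<in> Z" "ys \<in> set yss" "y \<in> set ys" for z ys y
  proof -
    obtain l where "l \<in> listset (map set yss)" "y \<in> set l"
      using ex_listset_through[OF ne', of "set ys" y] \<open>ys \<in> set yss\<close> \<open>y \<in> set ys\<close> by auto
    hence "y \<in> link adj W z" using X(1)[OF \<open>z \<in> Z\<close>] by (auto simp: clique_lists_def lists_over_def)
    thus ?thesis by (simp add: link_def adj_def insert_commute)
  qed
  have "\<not> free_of (complete_multipartite r s) G"
  proof (rule complete_multipartite_not_free[OF G, of "yss @ [zs]"])
    have "length zs = s r" using zs Z distinct_card by metis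
    thus "map length (yss @ [zs]) = map s [1..<Suc r]" using len r by simp
    show "\<forall>ys\<in>set (yss @ [zs]). set ys \<subseteq> verts G"
      using yss(1) AW X(2) zs by (fastforce simp: array_lists_def)
    show "\<forall>ys\<in>set (yss @ [zs]). distinct ys"
      using yss(2) zs by (auto simp: distinct_concat_iff)
    show "sorted_wrt (\<lambda>A B. \<forall>a\<in>A. \<forall>b\<in>B. {a, b} \<in> edges G) (map set (yss @ [zs]))"
      using sorted adjZ zs by (auto simp: sorted_wrt_append)
  qed
  thus False using free by simp
qed


section \<open>Cliques in graphs with a given number of edges\<close>

definition cliques :: "'a ugraph \<Rightarrow> nat \<Rightarrow> 'a set set" where
  "cliques G r = {S. S \<subseteq> verts G \<and> card S = r \<and> (\<forall>a\<in>S. \<forall>b\<in>S. a \<noteq> b \<longrightarrow> {a, b} \<in> edges G)}"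

lemma finite_cliques:
  assumes "simple_graph G"
  shows "finite (cliques G r)"
proof (rule finite_subset)
  show "cliques G r \<subseteq> Pow (verts G)" by (auto simp: cliques_def)
qed (use assms in \<open>simp add: simple_graph_def\<close>)

text \<open>All pairs of vertices of a copy are edges of it, so the copy is determined by its vertex
  set, which is a clique.\<close>

lemma card_copies_complete_graph_le:
  assumes "simple_graph G"
  shows "card (copies (complete_graph r) G) \<le> card (cliques G r)"
proof -
  have all: "edges H = {e. e \<subseteq> verts H \<and> card e = 2} \<and> card (verts H) = r"
    if "H \<in> copies (complete_graph r) G" for H
  proof -
    from that obtain f where f: "bij_betw f {1..r} (verts H)"
      and E: "edges H = (\<lambda>e. f ` e) ` {e. e \<subseteq> {1..r} \<and> card e = 2}"
      by (auto simp: copies_def graph_iso_def complete_graph_def)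
    have im: "f ` {1..r} = verts H" and inj: "inj_on f {1..r}" using f by (auto simp: bij_betw_def)
    have "edges H = {e. e \<subseteq> verts H \<and> card e = 2}"
    proof (intro equalityI subsetI)
      fix e assume "e \<in> edges H"
      then obtain e' where "e = f ` e'" "e' \<subseteq> {1..r}" "card e' = 2" using E by auto
      thus "e \<in> {e. e \<subseteq> verts H \<and> card e = 2}"
        using im inj by (auto simp: card_image inj_on_subset)
    next
      fix e assume "e \<in> {e. e \<subseteq> verts H \<and> card e = 2}"
      hence e: "e \<subseteq> f ` {1..r}" "card e = 2" using im by auto
      then obtain e' where e': "e' \<subseteq> {1..r}" "e = f ` e'" by (meson subset_imageE)
      hence "card e' = 2" using e inj by (metis card_image inj_on_subset)
      thus "e \<in> edges H" using e' E by blast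
    qed
    moreover have "card (verts H) = r" using bij_betw_same_card[OF f] by simp
    ultimately show ?thesis by blast
  qed
  show ?thesis
  proof (rule card_inj_on_le[of verts])
    show "inj_on verts (copies (complete_graph r) G)"
      by (rule inj_onI) (metis all prod.expand)
    show "verts ` copies (complete_graph r) G \<subseteq> cliques G r"
    proof safe
      fix H assume H: "H \<in> copies (complete_graph r) G"
      hence sub: "verts H \<subseteq> verts G" "edges H \<subseteq> edges G" by (auto simp: copies_def subgraph_def)
      have "{a, b} \<in> edges G" if "a \<in> verts H" "b \<in> verts H" "a \<noteq> b" for a b
      proof -
        have "{a, b} \<in> {e. e \<subseteq> verts H \<and> card e = 2}" using that by simp
        thus ?thesis using all[OF H] sub by blast
      qed
      thus "verts H \<in> cliques G r" using all[OF H] sub by (auto simp: cliques_def)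
    qed
    show "finite (cliques G r)"
      using assms by (rule finite_cliques)
  qed
qed

lemma sorted_wrt_if_pairwise:
  "distinct xs \<Longrightarrow> \<forall>a\<in>set xs. \<forall>b\<in>set xs. a \<noteq> b \<longrightarrow> P a b \<Longrightarrow> sorted_wrt P xs"
  by (induction xs) auto

text \<open>Such a clique has a root \<open>x\<close> in \<open>A\<close>, and any ordering of its
  other vertices is a clique list in the link of \<open>x\<close>.\<close>

lemma card_cliques_meeting_le:
  fixes G :: "'a ugraph"
  defines "adj \<equiv> \<lambda>u v. {u, v} \<in> edges G"
  assumes "finite W" "finite A"
  shows "card {S \<in> cliques G (Suc k). S \<subseteq> W \<and> S \<inter> A \<noteq> {}}
           \<le> (\<Sum>x\<in>A. card (clique_lists adj (link adj W x) k))"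
proof -
  let ?Q = "SIGMA x:A. clique_lists adj (link adj W x) k"
  have finQ: "finite ?Q" using assms by simp
  have "{S \<in> cliques G (Suc k). S \<subseteq> W \<and> S \<inter> A \<noteq> {}} \<subseteq> (\<lambda>(x, ys). insert x (set ys)) ` ?Q"
  proof
    fix S assume "S \<in> {S \<in> cliques G (Suc k). S \<subseteq> W \<and> S \<inter> A \<noteq> {}}"
    then obtain x where x: "x \<in> A" "x \<in> S" "S \<subseteq> W" "card S = Suc k"
      and adj: "\<And>a b. \<lbrakk>a \<in> S; b \<in> S; a \<noteq> b\<rbrakk> \<Longrightarrow> adj a b"
      by (auto simp: cliques_def adj_def)
    have "finite S" using x(3) assms(2) by (rule finite_subset)
    then obtain ys where ys: "set ys = S - {x}" "distinct ys"
      using finite_distinct_list[of "S - {x}"] by auto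
    have "length ys = card (S - {x})" using distinct_card[OF ys(2)] ys(1) by simp
    hence "length ys = k" using x(2,4) by simp
    moreover have "sorted_wrt adj ys" using ys adj by (intro sorted_wrt_if_pairwise) auto
    ultimately have "ys \<in> clique_lists adj (link adj W x) k"
      using ys x adj by (auto simp: clique_lists_def lists_over_def link_def)
    moreover have "S = insert x (set ys)" using ys x by auto
    ultimately show "S \<in> (\<lambda>(x, ys). insert x (set ys)) ` ?Q" using x by force
  qed
  hence "card {S \<in> cliques G (Suc k). S \<subseteq> W \<and> S \<inter> A \<noteq> {}} \<le> card ((\<lambda>(x, ys). insert x (set ys)) ` ?Q)"
    by (rule card_mono[OF finite_imageI[OF finQ]])
  also have "\<dots> \<le> card ?Q" by (rule card_image_le[OF finQ])
  finally have "card {S \<in> cliques G (Suc k). S \<subseteq> W \<and> S \<inter> A \<noteq> {}} \<le> card ?Q" .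
  thus ?thesis using assms by simp
qed

lemma card_adjacent_pairs_le:
  assumes "simple_graph G" "W \<subseteq> verts G"
  shows "card {(u, v). u \<in> W \<and> v \<in> W \<and> {u, v} \<in> edges G} \<le> 2 * card (edges G)"
proof -
  have fin: "finite (edges G)"
    using assms by (auto simp: simple_graph_def intro: finite_subset[of _ "Pow (verts G)"])
  have two: "finite {(u, v). {u, v} = e} \<and> card {(u, v). {u, v} = e} \<le> 2" if e: "e \<in> edges G" for e
  proof -
    obtain a b where "e = {a, b}"
      using e assms(1) unfolding simple_graph_def card_2_iff by blast
    hence sub: "{(u, v). {u, v} = e} \<subseteq> {(a, b), (b, a)}" by (auto simp: doubleton_eq_iff)
    have "card {(u, v). {u, v} = e} \<le> card {(a, b), (b, a)}" by (rule card_mono[OF _ sub]) simp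
    also have "\<dots> \<le> length [(a, b), (b, a)]"
      using card_length[of "[(a, b), (b, a)]"] by (simp only: list.set)
    finally have "card {(u, v). {u, v} = e} \<le> 2" by simp
    moreover have "finite {(u, v). {u, v} = e}" using sub by (rule finite_subset) simp
    ultimately show ?thesis by blast
  qed
  have "card {(u, v). u \<in> W \<and> v \<in> W \<and> {u, v} \<in> edges G} \<le> card (\<Union>e\<in>edges G. {(u, v). {u, v} = e})"
    using fin two by (intro card_mono) auto
  also have "\<dots> \<le> (\<Sum>e\<in>edges G. card {(u, v). {u, v} = e})" by (rule card_UN_le[OF fin])
  also have "\<dots> \<le> (\<Sum>e\<in>edges G. 2)" using two by (intro sum_mono) auto
  finally show ?thesis by simp
qed

section \<open>Splitting the cliques by degree\<close>

text \<open>\<open>T0\<close> accounts for cliques with a vertex of degree at most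
  \<open>d0\<close>, \<open>T1\<close> for those above \<open>d0\<close> with a vertex of degree at
  most \<open>d1\<close>, \<open>T2\<close> for those entirely above \<open>d1\<close>. The degree
  sum is at most \<open>x\<close>, so \<open>h\<close> and \<open>n\<close> bound the numbers of
  vertices above \<open>d0\<close> and \<open>d1\<close>.\<close>

lemma card_cliques_bound:
  fixes G :: "'a ugraph" and s :: "nat \<Rightarrow> nat" and d0 d1 :: real
  assumes G: "simple_graph G" and free: "free_of (complete_multipartite r s) G"
    and r: "r \<ge> 3" and s: "\<forall>i\<in>{1..r}. s i > 0"
    and d: "d0 > 0" "d1 > 0" and m: "card (edges G) > 0"
  defines "x \<equiv> 2 * real (card (edges G))"
  defines "h \<equiv> x / d0" and "n \<equiv> x / d1"
  defines "k \<equiv> r - 1" and "p \<equiv> (\<Prod>i=1..r-1. s i)" and "S \<equiv> (\<Sum>i=1..r-1. s i)"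
  obtains T0 T1 T2 :: real where "T0 \<ge> 0" "T1 \<ge> 0" "T2 \<ge> 0"
    "real (card (cliques G r)) \<le> T0 + T1 + T2"
    "T0 \<le> x * d0 ^ (r - 2)"
    "T1 ^ p * d1 ^ S \<le> d1 ^ (k * p) * h ^ (p - 1) *
       (real (s r) * (x * h ^ (S - 2)) + real (S\<^sup>2) * h * d1 ^ (S - 1))"
    "T2 ^ p * n ^ S \<le> n ^ (k * p) * n ^ (p - 1) *
       (real (s r) * (n\<^sup>2 * n ^ (S - 2)) + real (S\<^sup>2) * n * n ^ (S - 1))"
proof -
  define adj where "adj = (\<lambda>u v. {u, v} \<in> edges G)"
  define V where "V = verts G"
  define deg where "deg = (\<lambda>v. card (link adj V v))"
  define V0 where "V0 = {v \<in> V. real (deg v) \<le> d0}"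
  define W where "W = {v \<in> V. real (deg v) > d0}"
  define A where "A = {v \<in> W. real (deg v) \<le> d1}"
  define Hi where "Hi = {v \<in> V. real (deg v) > d1}"
  define ss where "ss = map s [1..<r]"
  define T where "T = (\<lambda>A W. real (\<Sum>x\<in>A. card (clique_lists adj (link adj W x) k)))"
  have fin: "finite V" "finite V0" "finite W" "finite A" "finite Hi"
    using G by (auto simp: V_def V0_def W_def A_def Hi_def simple_graph_def)
  have sub: "W \<subseteq> V" "A \<subseteq> V" "A \<subseteq> W" "Hi \<subseteq> V" by (auto simp: W_def A_def Hi_def)
  have setr: "set [1..<r] = {1..r-1}" using r by auto
  have "length ss = k" by (simp add: ss_def k_def)
  have ssp: "prod_list ss = p" "sum_list ss = S"
    using prod.distinct_set_conv_list[of "[1..<r]" s] sum.distinct_set_conv_list[of "[1..<r]" s]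
    by (simp_all only: ss_def p_def S_def setr distinct_upt)
  have pos: "\<forall>s\<in>set ss. s > 0" using s by (auto simp: ss_def)
  \<comment> \<open>Since \<open>r \<ge> 3\<close>, there are two parts whose heads can be
    compared.\<close>
  have ss: "ss = s 1 # s 2 # map s [3..<r]"
    using r by (simp add: ss_def upt_conv_Cons numeral_eq_Suc)
  have sumdeg: "(\<Sum>v\<in>V. real (deg v)) \<le> x"
  proof -
    have "(\<Sum>v\<in>V. deg v) = card (SIGMA v:V. link adj V v)"
      using fin by (simp add: deg_def)
    also have "(SIGMA v:V. link adj V v) = {(u, v). u \<in> V \<and> v \<in> V \<and> {u, v} \<in> edges G}"
      by (auto simp: link_def adj_def)
    also have "card \<dots> \<le> 2 * card (edges G)"
      using card_adjacent_pairs_le[OF G] by (simp add: V_def)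
    finally have "real (\<Sum>v\<in>V. deg v) \<le> real (2 * card (edges G))" by (simp only: of_nat_le_iff)
    thus ?thesis by (simp add: x_def)
  qed
  \<comment> \<open>Markov's inequality for the degrees.\<close>
  have large: "real (card {v \<in> V. real (deg v) > d}) \<le> x / d" if "d > 0" for d
  proof -
    have "real (card {v \<in> V. real (deg v) > d}) * d \<le> (\<Sum>v\<in>{v \<in> V. real (deg v) > d}. real (deg v))"
      by (rule sum_bounded_below) auto
    also have "\<dots> \<le> (\<Sum>v\<in>V. real (deg v))" using fin by (intro sum_mono2) auto
    also note sumdeg
    finally show ?thesis using that by (simp add: field_simps)
  qed
  have cardW: "real (card W) \<le> h" and cardHi: "real (card Hi) \<le> n"
    using large[OF d(1)] large[OF d(2)] by (simp_all add: W_def Hi_def h_def n_def)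
  have cardA: "real (card A) \<le> h"
    using cardW card_mono[OF fin(3) sub(3)] by linarith
  have few: "card {x \<in> A'. listset (map set yss) \<subseteq> clique_lists adj (link adj W' x) (length ss)} \<le> s r"
    if "A' \<subseteq> V" "W' \<subseteq> V" "yss \<in> array_lists ss W'" "distinct (concat yss)" for A' W' yss
    using free_of_few_common_neighbours[OF G free, of A' W' yss "length ss"] that r s
    by (simp add: adj_def V_def ss_def)
  have linkle: "card (link adj W' v) \<le> deg v" if "W' \<subseteq> V" for W' v
    unfolding deg_def using fin that by (intro card_mono) (auto simp: link_def)
  have n0: "n > 0" using m d by (simp add: n_def x_def)
  \<comment> \<open>Of the \<open>r - 1\<close> factors \<open>deg v\<close>, one is kept for the
    degree sum and the others are bounded by \<open>d0\<close>.\<close>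
  have T0: "T V0 V \<le> x * d0 ^ (r - 2)"
  proof -
    have "real (card (clique_lists adj (link adj V v) k)) \<le> real (deg v) * d0 ^ (r - 2)" if "v \<in> V0" for v
    proof -
      have "card (clique_lists adj (link adj V v) k) \<le> card (lists_over (link adj V v) k)"
        using fin by (intro card_mono) (auto simp: clique_lists_def)
      also have "\<dots> = deg v ^ k" using fin by (simp add: card_lists_over deg_def)
      also have "\<dots> = deg v * deg v ^ (r - 2)"
        using r by (simp add: k_def Suc_diff_Suc numeral_2_eq_2 flip: power_Suc)
      finally have "real (card (clique_lists adj (link adj V v) k)) \<le> real (deg v) * real (deg v) ^ (r - 2)"
        by (metis of_nat_le_iff of_nat_mult of_nat_power)
      also have "\<dots> \<le> real (deg v) * d0 ^ (r - 2)"
        using that by (intro mult_left_mono power_mono) (auto simp: V0_def)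
      finally show ?thesis .
    qed
    hence "T V0 V \<le> (\<Sum>v\<in>V0. real (deg v) * d0 ^ (r - 2))"
      unfolding T_def of_nat_sum by (rule sum_mono)
    also have "\<dots> = (\<Sum>v\<in>V0. real (deg v)) * d0 ^ (r - 2)" by (simp add: sum_distrib_right)
    also have "\<dots> \<le> (\<Sum>v\<in>V. real (deg v)) * d0 ^ (r - 2)"
      using fin d by (intro mult_right_mono sum_mono2) (auto simp: V0_def)
    also have "\<dots> \<le> x * d0 ^ (r - 2)" using sumdeg d by (intro mult_right_mono) auto
    finally show ?thesis .
  qed
  have T1: "T A W ^ p * d1 ^ S \<le> d1 ^ (k * p) * h ^ (p - 1) *
       (real (s r) * (x * h ^ (S - 2)) + real (S\<^sup>2) * h * d1 ^ (S - 1))"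
    unfolding T_def \<open>length ss = k\<close>[symmetric] ssp[symmetric]
  proof (rule rooted_clique_lists_bound[OF fin(4,3) ss pos])
    show "real (card (link adj W x)) \<le> d1" if "x \<in> A" for x
      using linkle[OF sub(1), of x] that by (auto simp: A_def)
    show "real (card {(u, v). u \<in> W \<and> v \<in> W \<and> adj u v}) \<le> x"
      using card_adjacent_pairs_le[OF G, of W] sub by (simp add: adj_def V_def x_def)
  qed (use cardA cardW few[of A W] sub d in auto)
  \<comment> \<open>Degrees have no upper bound here, so the size bound \<open>n\<close> of
    \<open>Hi\<close> also bounds the links, and \<open>n\<^sup>2\<close> bounds the adjacent
    pairs.\<close>
  have T2: "T Hi Hi ^ p * n ^ S \<le> n ^ (k * p) * n ^ (p - 1) *
       (real (s r) * (n\<^sup>2 * n ^ (S - 2)) + real (S\<^sup>2) * n * n ^ (S - 1))"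
    unfolding T_def \<open>length ss = k\<close>[symmetric] ssp[symmetric]
  proof (rule rooted_clique_lists_bound[OF fin(5,5) ss pos])
    show "real (card (link adj Hi x)) \<le> n" if "x \<in> Hi" for x
      using card_mono[OF fin(5), of "link adj Hi x"] cardHi by (force simp: link_def)
    have "card {(u, v). u \<in> Hi \<and> v \<in> Hi \<and> adj u v} \<le> card (Hi \<times> Hi)"
      using fin by (intro card_mono) auto
    hence "real (card {(u, v). u \<in> Hi \<and> v \<in> Hi \<and> adj u v}) \<le> (real (card Hi))\<^sup>2"
      by (simp add: card_cartesian_product power2_eq_square flip: of_nat_mult)
    also have "\<dots> \<le> n\<^sup>2" using cardHi by (intro power_mono) auto
    finally show "real (card {(u, v). u \<in> Hi \<and> v \<in> Hi \<and> adj u v}) \<le> n\<^sup>2" .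
  qed (use cardHi few[of Hi Hi] sub n0 in auto)
  have cov: "cliques G r \<subseteq> {S \<in> cliques G r. S \<subseteq> V \<and> S \<inter> V0 \<noteq> {}} \<union>
      {S \<in> cliques G r. S \<subseteq> W \<and> S \<inter> A \<noteq> {}} \<union> {S \<in> cliques G r. S \<subseteq> Hi \<and> S \<inter> Hi \<noteq> {}}"
  proof
    fix S assume S: "S \<in> cliques G r"
    hence "S \<subseteq> V" "S \<noteq> {}" using r by (auto simp: cliques_def V_def)
    consider "S \<inter> V0 \<noteq> {}" | "S \<inter> V0 = {}" "S \<inter> A \<noteq> {}" | "S \<inter> V0 = {}" "S \<inter> A = {}" by blast
    thus "S \<in> {S \<in> cliques G r. S \<subseteq> V \<and> S \<inter> V0 \<noteq> {}} \<union>
      {S \<in> cliques G r. S \<subseteq> W \<and> S \<inter> A \<noteq> {}} \<union> {S \<in> cliques G r. S \<subseteq> Hi \<and> S \<inter> Hi \<noteq> {}}"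
    proof cases
      case 2
      have "S \<subseteq> W" using 2(1) \<open>S \<subseteq> V\<close> by (force simp: V0_def W_def)
      thus ?thesis using S 2 by blast
    next
      case 3
      have "S \<subseteq> Hi" using 3 \<open>S \<subseteq> V\<close> by (force simp: V0_def W_def A_def Hi_def)
      thus ?thesis using S \<open>S \<noteq> {}\<close> by blast
    qed (use S \<open>S \<subseteq> V\<close> in blast)
  qed
  have cl: "real (card {S \<in> cliques G r. S \<subseteq> W' \<and> S \<inter> A' \<noteq> {}}) \<le> T A' W'"
    if "finite W'" "finite A'" for A' W'
    using card_cliques_meeting_le[OF that, of G k] r
    unfolding T_def adj_def of_nat_le_iff by (simp add: k_def)
  have finC: "finite (cliques G r)"
    using G by (rule finite_cliques)
  have "card (cliques G r) \<le> card ({S \<in> cliques G r. S \<subseteq> V \<and> S \<inter> V0 \<noteq> {}} \<union>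
      {S \<in> cliques G r. S \<subseteq> W \<and> S \<inter> A \<noteq> {}} \<union> {S \<in> cliques G r. S \<subseteq> Hi \<and> S \<inter> Hi \<noteq> {}})"
    using finC by (intro card_mono[OF _ cov]) auto
  also have "\<dots> \<le> card {S \<in> cliques G r. S \<subseteq> V \<and> S \<inter> V0 \<noteq> {}} +
      card {S \<in> cliques G r. S \<subseteq> W \<and> S \<inter> A \<noteq> {}} + card {S \<in> cliques G r. S \<subseteq> Hi \<and> S \<inter> Hi \<noteq> {}}"
    by (intro order_trans[OF card_Un_le] add_right_mono card_Un_le)
  finally have "real (card (cliques G r)) \<le> T V0 V + T A W + T Hi Hi"
    using cl[OF fin(1,2)] cl[OF fin(3,4)] cl[OF fin(5,5)] by linarith
  moreover have "T A' W' \<ge> 0" for A' W' by (simp add: T_def sum_nonneg)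
  ultimately show ?thesis by (intro that[of "T V0 V" "T A W" "T Hi Hi"] T0 T1 T2)
qed


section \<open>The power saving\<close>

lemma root_bound:
  fixes T C y e c \<eta> :: real
  assumes "T \<ge> 0" "p > 0" "y \<ge> 1" "C \<ge> 0" "T ^ p \<le> C * y powr c" "c \<le> (e - \<eta>) * real p"
  shows "T \<le> root p C * y powr (e - \<eta>)"
proof (rule power_le_imp_le_base)
  have "T ^ p \<le> C * y powr c" by fact
  also have "\<dots> \<le> C * y powr ((e - \<eta>) * real p)"
    using assms by (intro mult_left_mono powr_mono) auto
  also have "\<dots> = (root p C * y powr (e - \<eta>)) ^ p"
    using assms by (simp add: power_mult_distrib powr_power mult.commute)
  finally show "T ^ Suc (p - 1) \<le> (root p C * y powr (e - \<eta>)) ^ Suc (p - 1)"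
    using assms by simp
  show "0 \<le> root p C * y powr (e - \<eta>)" using assms by simp
qed

text \<open>The thresholds are \<open>m powr (a - \<delta>)\<close> and
  \<open>m powr (a + \<delta>)\<close>. Moving them away from the balanced degree saves a power in
  \<open>T0\<close> and \<open>T2\<close>; \<open>T1\<close> has a saving of its own that survives a
  small \<open>\<delta>\<close>.\<close>

lemma mex_power_saving:
  fixes r :: nat and s :: "nat \<Rightarrow> nat"
  assumes r: "r \<ge> 3" and s: "\<forall>i\<in>{1..r}. s i > 0"
  defines "\<sigma> \<equiv> real r - 1 / real (\<Prod>i=1..r-1. s i)"
  defines "e \<equiv> (real r - 1) * \<sigma> / (real r + \<sigma> - 2)"
  obtains C \<eta> :: real where "\<eta> > 0"
    "\<And>m. m \<ge> 1 \<Longrightarrow> real (mex m (complete_graph r) (complete_multipartite r s)) \<le> C * real m powr (e - \<eta>)"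
proof -
  define p S k where "p = (\<Prod>i=1..r-1. s i)" and "S = (\<Sum>i=1..r-1. s i)" and "k = r - 1"
  have p: "p \<ge> 1" using s by (auto simp: p_def Suc_le_eq intro!: prod_pos)
  have S2: "S \<ge> 2"
  proof -
    have "(\<Sum>i=1..r-1. 1) \<le> S" unfolding S_def using s by (intro sum_mono) (auto simp: Suc_le_eq)
    thus ?thesis using r by simp
  qed
  have Sle: "S \<le> k * p"
  proof -
    have "s i \<le> p" if "i \<in> {1..r-1}" for i
    proof -
      have "s i dvd p" unfolding p_def using that by (intro dvd_prodI) auto
      thus ?thesis using p by (intro dvd_imp_le) auto
    qed
    hence "S \<le> (\<Sum>i=1..r-1. p)" unfolding S_def by (rule sum_mono)
    thus ?thesis by (simp add: k_def)
  qed
  have rk: "real r = real k + 1" and k2: "real k \<ge> 2" using r by (auto simp: k_def)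
  \<comment> \<open>In these terms \<open>\<sigma> = r - \<epsilon>\<close> and
    \<open>den = r + \<sigma> - 2\<close>. At most about \<open>m powr b\<close> vertices have
    degree above \<open>m powr a\<close>; the two forms of \<open>e\<close> below,
    \<open>b * \<sigma>\<close> and \<open>b + k * a\<close>, match the bound of Erdos on these
    vertices and the low degree bound.\<close>
  define \<epsilon> den where "\<epsilon> = 1 / real p" and "den = 2 * real k - \<epsilon>"
  define a b where "a = (real k - \<epsilon>) / den" and "b = real k / den"
  have \<epsilon>: "0 < \<epsilon>" "\<epsilon> \<le> 1" "\<epsilon> * real p = 1" using p by (auto simp: \<epsilon>_def)
  have den: "den > 0" using k2 \<epsilon> by (simp add: den_def)
  have \<sigma>: "\<sigma> = real k + 1 - \<epsilon>" by (simp add: \<sigma>_def rk \<epsilon>_def p_def)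
  have "e = real k * \<sigma> / den" by (simp add: e_def rk \<sigma> den_def)
  hence e\<sigma>: "e = b * \<sigma>" by (simp add: b_def)
  have ab: "a + b = 1"
    using den by (simp add: a_def b_def den_def add_divide_distrib[symmetric])
  have "b - a = \<epsilon> / den" by (simp add: a_def b_def diff_divide_distrib)
  hence b\<epsilon>: "b * \<epsilon> = real k * (b - a)" by (simp add: b_def)
  have eka: "e = b + real k * a" using b\<epsilon> by (simp add: e\<sigma> \<sigma> algebra_simps)
  have a0: "a > 0" using k2 \<epsilon> den by (simp add: a_def)
  \<comment> \<open>What the main term of \<open>T1 ^ p\<close> saves over \<open>e * p\<close> when
    \<open>\<delta>\<close> is 0; it is positive because \<open>S - 1 < k * p\<close> and
    \<open>b - a = \<epsilon> / den\<close>.\<close>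
  have gap: "b - (real S - 1) * (b - a) > 0"
  proof -
    have "real S \<le> real k * real p" using Sle by (simp flip: of_nat_mult)
    hence "(real S - 1) * \<epsilon> < real k * real p * \<epsilon>" using \<epsilon> by (intro mult_strict_right_mono) auto
    also have "\<dots> = real k" using \<epsilon>(3) by (simp add: mult.assoc mult.commute)
    finally have "(real S - 1) * \<epsilon> / den < real k / den" using den by (simp add: divide_strict_right_mono)
    thus ?thesis using \<open>b - a = \<epsilon> / den\<close> by (simp add: b_def)
  qed
  \<comment> \<open>The term from repeated vertices saves \<open>a\<close>. Half of \<open>g\<close>
    is reserved for the cost of \<open>\<delta>\<close>, which is at most
    \<open>r * p * \<delta>\<close> in the exponent.\<close>
  define g where "g = min a (b - (real S - 1) * (b - a))"
  have g: "g > 0" "g \<le> a" "g \<le> b - (real S - 1) * (b - a)" using a0 gap by (auto simp: g_def)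
  define \<delta> where "\<delta> = g / (2 * (real r * real p))"
  have rp: "real r * real p \<ge> 3" using r p mult_mono[of 3 "real r" 1 "real p"] by simp
  have \<delta>: "\<delta> > 0" "real r * real p * \<delta> = g / 2" using g p r by (auto simp: \<delta>_def)
  \<comment> \<open>The savings in \<open>T0\<close>, \<open>T1\<close> and \<open>T2\<close>; the
    last two are divided by \<open>p\<close> since they come from bounds on \<open>p\<close>-th
    powers.\<close>
  define \<eta> where "\<eta> = min ((real r - 2) * \<delta>) (min (g / 2 / real p) (\<delta> * (real r * real p - 1) / real p))"
  have "\<eta> > 0" using \<delta> g p rp r by (simp add: \<eta>_def)
  have \<eta>: "\<eta> \<le> (real r - 2) * \<delta>" "\<eta> * real p \<le> g / 2" "\<eta> * real p \<le> \<delta> * (real r * real p - 1)"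
  proof -
    have "\<eta> \<le> g / 2 / real p" "\<eta> \<le> \<delta> * (real r * real p - 1) / real p"
      by (simp_all add: \<eta>_def)
    thus "\<eta> * real p \<le> g / 2" "\<eta> * real p \<le> \<delta> * (real r * real p - 1)"
      using p by (simp_all add: pos_le_divide_eq)
  qed (simp add: \<eta>_def)
  define t where "t = real (s r)"
  define C1 where "C1 = t * 2 ^ (p - 1) * 2 * 2 ^ (S - 2) + real (S\<^sup>2) * 2 ^ (p - 1) * 2"
  define C2 where "C2 = (t + real (S\<^sup>2)) * 2 ^ (k * p + (p - 1))"
  have C0: "C1 \<ge> 0" "C2 \<ge> 0" by (auto simp: C1_def C2_def t_def)
  have main: "real (card (copies (complete_graph r) G)) \<le> (2 + root p C1 + root p C2) * real m powr (e - \<eta>)"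
    if G: "simple_graph G" "card (edges G) = m" "free_of (complete_multipartite r s) G" and m: "m \<ge> 1"
    for m and G :: "nat ugraph"
  proof -
    define y where "y = real m"
    have y: "y \<ge> 1" using m by (simp add: y_def)
    have pw: "(y powr c) ^ n = y powr (c * real n)" for c n
      using y by (simp add: powr_power mult.commute)
    define d0 d1 where "d0 = y powr (a - \<delta>)" and "d1 = y powr (a + \<delta>)"
    define h n where "h = 2 * y / d0" and "n = 2 * y / d1"
    have d: "d0 > 0" "d1 > 0" using y by (auto simp: d0_def d1_def)
    have "y powr (b + \<delta>) * d0 = y powr (a + b)" "y powr (b - \<delta>) * d1 = y powr (a + b)"
      by (simp_all add: d0_def d1_def flip: powr_add) (simp_all add: add.commute)
    hence h: "h = 2 * y powr (b + \<delta>)" and n: "n = 2 * y powr (b - \<delta>)"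
      using y d by (simp_all add: h_def n_def ab field_simps)
    have "card (edges G) > 0" using G(2) m by simp
    note bound = card_cliques_bound[OF G(1,3) r s d this, unfolded G(2),
        folded p_def S_def y_def t_def, folded k_def h_def n_def]
    obtain T0 T1 T2 :: real where T: "T0 \<ge> 0" "T1 \<ge> 0" "T2 \<ge> 0"
      and cl: "real (card (cliques G r)) \<le> T0 + T1 + T2"
      and T0: "T0 \<le> 2 * y * d0 ^ (r - 2)"
      and T1: "T1 ^ p * d1 ^ S \<le> d1 ^ (k * p) * h ^ (p - 1) *
         (t * (2 * y * h ^ (S - 2)) + real (S\<^sup>2) * h * d1 ^ (S - 1))"
      and T2: "T2 ^ p * n ^ S \<le> n ^ (k * p) * n ^ (p - 1) *
         (t * (n\<^sup>2 * n ^ (S - 2)) + real (S\<^sup>2) * n * n ^ (S - 1))"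
      by (rule bound)
    have "T0 \<le> 2 * y powr (e - \<eta>)"
    proof -
      have "T0 \<le> 2 * (y powr 1 * y powr ((a - \<delta>) * real (r - 2)))"
        using T0 y by (simp add: d0_def pw mult.assoc)
      also have "\<dots> = 2 * y powr (1 + (a - \<delta>) * real (r - 2))"
        by (simp only: powr_add)
      also have "1 + (a - \<delta>) * real (r - 2) = e - (real r - 2) * \<delta>"
        using r ab by (simp add: eka rk of_nat_diff algebra_simps)
      also have "2 * y powr (e - (real r - 2) * \<delta>) \<le> 2 * y powr (e - \<eta>)"
        using \<eta>(1) y by (intro mult_left_mono powr_mono) auto
      finally show ?thesis .
    qed
    moreover have "T1 \<le> root p C1 * y powr (e - \<eta>)"
    proof (rule root_bound)
      \<comment> \<open>The exponents of \<open>y\<close> in the two terms on the right, to be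
        compared with the target plus the exponent of \<open>d1 ^ S\<close>.\<close>
      let ?X1 = "(a + \<delta>) * real (k * p) + (b + \<delta>) * real (p - 1) + 1 + (b + \<delta>) * real (S - 2)"
      let ?X2 = "(a + \<delta>) * real (k * p) + (b + \<delta>) * real (p - 1) + (b + \<delta>) + (a + \<delta>) * real (S - 1)"
      let ?Z = "(e - \<eta>) * real p"
      have nat: "real (p - 1) = real p - 1" "real (S - 2) = real S - 2" "real (S - 1) = real S - 1"
        using p S2 by auto
      have slack: "real k * real p * \<delta> + real p * \<delta> = g / 2"
        using \<delta>(2) by (simp add: rk algebra_simps)
      have ep: "e * real p = b * real p + real k * real p * a" by (simp add: eka algebra_simps)
      have X1: "?X1 \<le> ?Z + (a + \<delta>) * real S"
      proof -
        have "?X1 - (a + \<delta>) * real S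
            = e * real p - (b - (real S - 1) * (b - a)) + (real k * real p * \<delta> + real p * \<delta> - 3 * \<delta>)"
          unfolding nat ep of_nat_mult using ab by (simp add: algebra_simps)
        also have "\<dots> \<le> e * real p - g / 2" using slack g \<delta> by simp
        also have "\<dots> \<le> ?Z" using \<eta>(2) by (simp add: left_diff_distrib)
        finally show ?thesis by simp
      qed
      have X2: "?X2 \<le> ?Z + (a + \<delta>) * real S"
      proof -
        have "?X2 - (a + \<delta>) * real S
            = e * real p - a + (real k * real p * \<delta> + real p * \<delta> - \<delta>)"
          unfolding nat ep of_nat_mult by (simp add: algebra_simps)
        also have "\<dots> \<le> e * real p - g / 2" using slack g \<delta> by simp
        also have "\<dots> \<le> ?Z" using \<eta>(2) by (simp add: left_diff_distrib)
        finally show ?thesis by simp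
      qed
      have "T1 ^ p * d1 ^ S \<le> (t * 2 ^ (p - 1) * 2 * 2 ^ (S - 2)) *
           (y powr ((a + \<delta>) * real (k * p)) * y powr ((b + \<delta>) * real (p - 1)) * y powr 1 *
            y powr ((b + \<delta>) * real (S - 2))) +
         (real (S\<^sup>2) * 2 ^ (p - 1) * 2) *
           (y powr ((a + \<delta>) * real (k * p)) * y powr ((b + \<delta>) * real (p - 1)) * y powr (b + \<delta>) *
            y powr ((a + \<delta>) * real (S - 1)))"
        using T1 y unfolding h d1_def power_mult_distrib pw powr_one_gt_zero_iff
        by (simp only: powr_one distrib_left mult_ac)
      also have "\<dots> = (t * 2 ^ (p - 1) * 2 * 2 ^ (S - 2)) * y powr ?X1 +
          (real (S\<^sup>2) * 2 ^ (p - 1) * 2) * y powr ?X2"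
        by (simp only: powr_add)
      also have "\<dots> \<le> (t * 2 ^ (p - 1) * 2 * 2 ^ (S - 2)) * y powr (?Z + (a + \<delta>) * real S) +
          (real (S\<^sup>2) * 2 ^ (p - 1) * 2) * y powr (?Z + (a + \<delta>) * real S)"
        using y by (intro add_mono mult_left_mono powr_mono X1 X2) (auto simp: t_def)
      also have "\<dots> = C1 * y powr ?Z * d1 ^ S"
        unfolding d1_def pw by (simp only: C1_def powr_add distrib_right mult.assoc)
      finally show "T1 ^ p \<le> C1 * y powr ?Z"
        by (rule mult_right_le_imp_le) (use d in simp)
    qed (use T p y C0 in auto)
    moreover have "T2 \<le> root p C2 * y powr (e - \<eta>)"
    proof (rule root_bound)
      have n0: "n > 0" using y d by (simp add: n_def)
      obtain j where j: "S = Suc (Suc j)" using S2 by (metis add_2_eq_Suc le_Suc_ex)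
      have nS: "n\<^sup>2 * n ^ (S - 2) = n ^ S" "n * n ^ (S - 1) = n ^ S"
        by (simp_all add: j power2_eq_square mult.assoc)
      \<comment> \<open>Both terms contain exactly \<open>n ^ S\<close>. Cancelling it leaves the
        bound of Erdos on \<open>n\<close> vertices, with exponent
        \<open>r * p - 1 = \<sigma> * p\<close>.\<close>
      have "T2 ^ p * n ^ S \<le> (t + real (S\<^sup>2)) * n ^ (k * p + (p - 1)) * n ^ S"
        using T2 unfolding mult.assoc nS by (simp only: power_add distrib_right mult_ac distrib_left)
      hence "T2 ^ p \<le> (t + real (S\<^sup>2)) * n ^ (k * p + (p - 1))"
        by (rule mult_right_le_imp_le) (use n0 in simp)
      also have "\<dots> = C2 * y powr ((b - \<delta>) * real (k * p + (p - 1)))"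
        by (simp only: n power_mult_distrib pw C2_def mult.assoc)
      finally show "T2 ^ p \<le> C2 * y powr ((b - \<delta>) * real (k * p + (p - 1)))" .
      have nat: "real (k * p + (p - 1)) = real r * real p - 1" using p by (simp add: rk algebra_simps)
      have "b * (real r * real p - 1) = e * real p"
        using \<epsilon>(3) by (simp add: e\<sigma> \<sigma> rk algebra_simps)
      thus "(b - \<delta>) * real (k * p + (p - 1)) \<le> (e - \<eta>) * real p"
        using \<eta>(3) unfolding nat by (simp add: left_diff_distrib)
    qed (use T p y C0 in auto)
    moreover have "real (card (copies (complete_graph r) G)) \<le> T0 + T1 + T2"
      using card_copies_complete_graph_le[OF G(1), of r] cl by linarith
    ultimately show ?thesis by (simp add: y_def algebra_simps)
  qed
  have "real (mex m (complete_graph r) (complete_multipartite r s))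
      \<le> (2 + root p C1 + root p C2) * real m powr (e - \<eta>)" if "m \<ge> 1" for m
  proof -
    \<comment> \<open>The maximum is attained, as the set of counts is finite and nonempty, so the
      bound for single graphs applies to it.\<close>
    have "mex m (complete_graph r) (complete_multipartite r s)
        \<in> copy_counts m (complete_graph r) (complete_multipartite r s)"
      unfolding mex_def using r s
      by (intro Max_in finite_copy_counts_complete_graph copy_counts_nonempty) auto
    thus ?thesis using main[OF _ _ _ that] by (auto simp: copy_counts_def)
  qed
  with \<open>\<eta> > 0\<close> show ?thesis by (rule that)
qed

theorem theorem4p6:
  fixes r :: nat and s :: "nat \<Rightarrow> nat"
  assumes "r \<ge> 3"
    and "\<forall>i\<in>{1..r}. s i > 0"
    and "mono_on {1..r} s"
  shows "let \<sigma> = real r - 1 / real (\<Prod>i=1..r-1. s i)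
         in (\<lambda>m. real (mex m (complete_graph r) (complete_multipartite r s)))
              \<in> o[at_top](\<lambda>m. real m powr ((real r - 1) * \<sigma> / (real r + \<sigma> - 2)))"
proof -
  define \<sigma> where "\<sigma> = real r - 1 / real (\<Prod>i=1..r-1. s i)"
  define e where "e = (real r - 1) * \<sigma> / (real r + \<sigma> - 2)"
  obtain C \<eta> where \<eta>: "\<eta> > 0" and
    C: "\<And>m. m \<ge> 1 \<Longrightarrow> real (mex m (complete_graph r) (complete_multipartite r s)) \<le> C * real m powr (e - \<eta>)"
    using mex_power_saving[OF assms(1,2)] unfolding e_def \<sigma>_def by metis
  have "(\<lambda>m. real (mex m (complete_graph r) (complete_multipartite r s)))
      \<in> O[at_top](\<lambda>m. real m powr (e - \<eta>))"
    by (intro bigoI[of _ C] eventually_mono[OF eventually_ge_at_top[of 1]]) (simp add: C)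
  also have "(\<lambda>m. real m powr (e - \<eta>)) \<in> o[at_top](\<lambda>m. real m powr e)"
  proof (rule smalloI_tendsto)
    have "((\<lambda>m. real m powr - \<eta>) \<longlongrightarrow> 0) at_top"
      using \<eta> by (intro tendsto_neg_powr filterlim_real_sequentially) auto
    moreover have "\<forall>\<^sub>F m in at_top. real m powr - \<eta> = real m powr (e - \<eta>) / real m powr e"
      by (rule eventually_mono[OF eventually_gt_at_top[of 0]]) (simp flip: powr_diff)
    ultimately show "((\<lambda>m. real m powr (e - \<eta>) / real m powr e) \<longlongrightarrow> 0) at_top"
      by (rule Lim_transform_eventually)
    show "\<forall>\<^sub>F m in at_top. real m powr e \<noteq> 0"
      by (rule eventually_mono[OF eventually_gt_at_top[of 0]]) simp
  qed
  finally show ?thesis by (simp add: Let_def e_def \<sigma>_def)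
qed

end
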